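(* Let $\mathbb{F}$ be a finite field with $q$ elements, let $\alpha$ be a primitive element of $\mathbb{F}$, put $n=q$, let $1\le k\le n-1$ and $l\ge 1$ be integers, and let $v=(v_1,\dots,v_n)=(0,\alpha^0,\alpha^1,\dots,\alpha^{q-2})$. Let $A\in\mathbb{F}^{n\times l}$ be a codeword of the interleaved Reed-Solomon code $\mathcal{IRS}^*(q,l,k)$, let $E\in\mathbb{F}^{n\times l}$ be an arbitrary matrix (the error matrix), and let $Y=A+E$. Let $\mathcal{F}\subseteq\{1,\dots,n\}$ be the set of indices of the non-zero rows of $E$ and let $f=|\mathcal{F}|$. Let $S=H\cdot Y\in\mathbb{F}^{(n-k)\times l}$ be the syndrome matrix, with rows $S_1,\dots,S_{n-k}$, where $H\in\mathbb{F}^{(n-k)\times n}$ is the matrix with entries $H_{r,i}=v_i^{\,r-1}$ ($1\le r\le n-k$, $1\le i\le n$). Assume that (i) the non-zero rows $E_i$ ($i\in\mathcal{F}$) of $E$ are linearly independent over $\mathbb{F}$; and (ii) $f\le \min\{l,\;n-k-1\}$. Let $\hat f$ be the smallest integer with $0\le\hat f\le n-k-1$ such that row $S_{\hat f+1}$ is an $\mathbb{F}$-linear combination of the preceding rows $S_1,\dots,S_{\hat f}$ (such an integer exists under these assumptions), and let $\lambda_1,\dots,\lambda_{\hat f}\in\mathbb{F}$ be the uniquely determined coefficients with $S_{\hat f+1}=\sum_{j=1}^{\hat f}\lambda_j S_j$. Then $\hat f=f$, and the polynomial $$\Lambda(x)=x^{\hat f}-\sum_{j=1}^{\hat f}\lambda_j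 x^{j-1}\in\mathbb{F}[x]$$ is the error locator polynomial, i.e. for every $i\in\{1,\dots,n\}$, $$\Lambda(v_i)=0\iff i\in\mathcal{F}.$$
   Context: The code $\mathcal{RS}^*(q,k)$ is the extended Reed-Solomon code of length $n=q$ and dimension $k$ over $\mathbb{F}$: the set of all vectors $(p(v_1),\dots,p(v_n))\in\mathbb{F}^n$, where $p$ ranges over all polynomials over $\mathbb{F}$ of degree $<k$ and $v=(v_1,\dots,v_n)=(0,\alpha^0,\alpha^1,\dots,\alpha^{q-2})$. The interleaved Reed-Solomon code $\mathcal{IRS}^*(q,l,k)$ of interleaving depth $l$ is the set of all matrices $A\in\mathbb{F}^{n\times l}$ each of whose $l$ columns is (the transpose of) a codeword of $\mathcal{RS}^*(q,k)$. The convention $0^0=1$ is used in the definition of $H$, so the first row of $H$ is all ones and the column of $H$ corresponding to $v_1=0$ is $(1,0,\dots,0)^\top$. An empty linear combination is the zero vector and an empty sum is $0$; thus $\hat f=0$ means $S_1=0$. The coefficients $\lambda_j$ are equivalently the entries of row $\hat f+1$ in the first $\hat f$ columns of the matrix obtained from $S$ by Gauss-Jordan elimination with elementary column operations, whose first $\hat f$ rows have the form $(I_{\hat f}\mid 0)$ with $I_{\hat f}$ the identity matrix and whose row $\hat f+1$ is $(\lambda_1,\dots,\lambda_{\hat f},0,\dots,0)$. *)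

theory Defs
  imports
    "Jordan_Normal_Form.VS_Connect"
    "HOL-Computational_Algebra.Polynomial"
    "HOL-Library.Cardinality"
begin

text \<open>
  The field is an arbitrary type of class field and finite, with \<open>q = CARD('a)\<close> elements.
  Indices of vectors and matrices start at 0, so entry \<open>i\<close>, row \<open>r\<close> below is entry \<open>i + 1\<close>,
  row \<open>r + 1\<close> in the usual one-based notation.
\<close>

definition primitive_element :: "'a::{field,finite} \<Rightarrow> bool" where
  "primitive_element \<alpha> \<longleftrightarrow> \<alpha> \<noteq> 0 \<and> (\<forall>x. x \<noteq> 0 \<longrightarrow> (\<exists>i::nat. x = \<alpha> ^ i))"

text \<open>The code locators \<open>(0, \<alpha>^0, \<alpha>^1, \<dots>, \<alpha>^(q-2))\<close>.\<close>

definition locators :: "'a::{field,finite} \<Rightarrow> 'a vec" where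
  "locators \<alpha> = vec CARD('a) (\<lambda>i. if i = 0 then 0 else \<alpha> ^ (i - 1))"

text \<open>
  The disjunct \<open>p = 0\<close> is needed only for \<open>k = 0\<close>, as the library assigns degree 0 to
  the zero polynomial.
\<close>

definition RS_code :: "'a::{field,finite} \<Rightarrow> nat \<Rightarrow> 'a vec set" where
  "RS_code \<alpha> k =
     {vec CARD('a) (\<lambda>i. poly p (locators \<alpha> $ i)) | p. p = 0 \<or> Polynomial.degree p < k}"

definition IRS_code :: "'a::{field,finite} \<Rightarrow> nat \<Rightarrow> nat \<Rightarrow> 'a mat set" where
  "IRS_code \<alpha> l k = {A \<in> carrier_mat CARD('a) l. \<forall>j<l. col A j \<in> RS_code \<alpha> k}"

text \<open>Here \<open>0 ^ 0 = 1\<close>, so the row with index 0 is all ones.\<close>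

definition check_matrix :: "'a::{field,finite} \<Rightarrow> nat \<Rightarrow> 'a mat" where
  "check_matrix \<alpha> k = mat (CARD('a) - k) CARD('a) (\<lambda>(r, i). (locators \<alpha> $ i) ^ r)"

definition nonzero_rows :: "'a::zero mat \<Rightarrow> nat set" where
  "nonzero_rows E = {i. i < dim_row E \<and> row E i \<noteq> 0\<^sub>v (dim_col E)}"

text \<open>
  The library's linear independence is about sets of vectors; injectivity of \<open>row E\<close> on \<open>I\<close>
  makes it linear independence of the family of rows (repeated rows are dependent).
\<close>

definition rows_lin_indpt :: "'a::field mat \<Rightarrow> nat set \<Rightarrow> bool" where
  "rows_lin_indpt E I \<longleftrightarrow> inj_on (row E) I \<and>
     \<not> module.lin_dep class_ring (module_vec TYPE('a) (dim_col E)) (row E ` I)"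

text \<open>
  \<open>c\<close> is a coefficient vector that expresses row \<open>m\<close> of \<open>S\<close> as a linear combination of the
  rows \<open>0, \<dots>, m - 1\<close>.  For \<open>m = 0\<close> the sum is empty, so row 0 has to be the zero vector.
\<close>

definition row_coeffs :: "'a::field mat \<Rightarrow> nat \<Rightarrow> 'a vec \<Rightarrow> bool" where
  "row_coeffs S m c \<longleftrightarrow> c \<in> carrier_vec m \<and>
     row S m = finsum_vec TYPE('a) (dim_col S) (\<lambda>j. c $ j \<cdot>\<^sub>v row S j) {0..<m}"

definition dependent_row :: "'a::field mat \<Rightarrow> nat \<Rightarrow> bool" where
  "dependent_row S m \<longleftrightarrow> m < dim_row S \<and> (\<exists>c. row_coeffs S m c)"

definition first_dependent_row :: "'a::field mat \<Rightarrow> nat" where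
  "first_dependent_row S = (LEAST m. dependent_row S m)"

text \<open>The polynomial \<open>x^m - (c_0 + c_1 x + \<dots> + c_(m-1) x^(m-1))\<close>.\<close>

definition locator_poly :: "nat \<Rightarrow> 'a::field vec \<Rightarrow> 'a poly" where
  "locator_poly m c = Polynomial.monom 1 m - (\<Sum>j<m. Polynomial.monom (c $ j) j)"

end

theory Submission
  imports Defs
begin

text \<open>
  Sums of \<open>x\<^sup>m\<close> over the whole field vanish for \<open>m < q - 1\<close>, hence \<open>H\<close> annihilates the code
  and \<open>S = H E\<close>. Consequently \<open>\<Sum>\<^sub>r d\<^sub>r S\<^sub>r = \<Sum>\<^sub>i D(v\<^sub>i) E\<^sub>i\<close> for every polynomial
  \<open>D = \<Sum>\<^sub>r d\<^sub>r x\<^sup>r\<close> of degree below \<open>n - k\<close>, and independence of the error rows turns relations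
  among syndrome rows into polynomials vanishing at all error locators. The monic ones have degree
  at least \<open>f\<close>, and the product of the factors \<open>x - v\<^sub>i\<close> is the only one of degree \<open>f\<close>.
\<close>

section \<open>Power sums and the multiplicative group of a finite field\<close>

lemma two_le_card_field: "2 \<le> CARD('a::{field,finite})"
proof -
  have "card {0, 1::'a} \<le> CARD('a)"
    by (rule card_mono) auto
  then show ?thesis by simp
qed

text \<open>For \<open>m > 0\<close>, replacing \<open>x\<close> by \<open>a * x\<close> permutes
  the field and multiplies the sum by \<open>a ^ m\<close>, so some nonzero \<open>a\<close> with
  \<open>a ^ m \<noteq> 1\<close> forces the sum to vanish.\<close>

lemma sum_power_UNIV_eq_0:
  assumes "m < CARD('a::{field,finite}) - 1"
  shows "(\<Sum>x\<in>UNIV. (x::'a) ^ m) = 0"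
proof (cases "m = 0")
  case True
  \<comment> \<open>Translation by 1 permutes the field; comparing both sides shows that the sum of
    \<open>CARD('a)\<close> ones is 0.\<close>
  have "(\<Sum>x\<in>UNIV. (x::'a)) = (\<Sum>x\<in>UNIV. x + 1)"
    by (rule sum.reindex_bij_witness[where i = "\<lambda>x. x + 1" and j = "\<lambda>x. x - 1"]) auto
  then show ?thesis
    using True by (simp add: sum.distrib)
next
  case False
  define p :: "'a poly" where "p = Polynomial.monom 1 m - 1"
  have deg: "Polynomial.degree p \<le> m"
    unfolding p_def by (intro degree_diff_le) (auto simp: degree_monom_le)
  have "coeff p m = 1"
    using False by (simp add: p_def)
  then have "p \<noteq> 0" by auto
  then have "card {x. poly p x = 0} \<le> m"
    using card_poly_roots_bound[of p] deg by linarith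
  moreover have "card (UNIV - {0::'a}) = CARD('a) - 1"
    by (simp add: card_Diff_singleton)
  \<comment> \<open>The polynomial \<open>x ^ m - 1\<close> has at most \<open>m\<close> roots,
    fewer than there are nonzero elements.\<close>
  ultimately have "\<not> UNIV - {0} \<subseteq> {x. poly p x = 0}"
    using assms card_mono[of "{x. poly p x = 0}" "UNIV - {0}"] by auto
  then obtain a :: 'a where a: "a \<noteq> 0" "a ^ m \<noteq> 1"
    by (auto simp: p_def poly_monom)
  have "(\<Sum>x\<in>UNIV. x ^ m) = (\<Sum>x\<in>UNIV. (a * x) ^ m)"
    by (rule sum.reindex_bij_witness[where i = "\<lambda>x. a * x" and j = "\<lambda>x. x / a"])
      (use a in auto)
  also have "\<dots> = a ^ m * (\<Sum>x\<in>UNIV. x ^ m)"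
    by (simp add: power_mult_distrib sum_distrib_left)
  finally show ?thesis
    using a by (simp add: mult_cancel_right1)
qed

lemma sum_poly_UNIV_eq_0:
  assumes "Polynomial.degree p < CARD('a::{field,finite}) - 1"
  shows "(\<Sum>x\<in>UNIV. poly p (x::'a)) = 0"
proof -
  have "(\<Sum>x\<in>UNIV. poly p x) =
      (\<Sum>i\<le>Polynomial.degree p. coeff p i * (\<Sum>x\<in>UNIV. x ^ i))"
    by (subst sum_distrib_left, subst sum.swap) (simp add: poly_altdef)
  also have "\<dots> = 0"
    using assms by (intro sum.neutral) (auto simp: sum_power_UNIV_eq_0)
  finally show ?thesis .
qed

text \<open>Multiplication by \<open>a\<close> permutes the nonzero elements, and their nonzero
  product can be cancelled.\<close>

lemma power_card_minus_1_eq_1: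
  assumes "(a::'a::{field,finite}) \<noteq> 0"
  shows "a ^ (CARD('a) - 1) = 1"
proof -
  have "(\<Prod>x\<in>UNIV - {0}. x) = (\<Prod>x\<in>UNIV - {0}. a * x)"
    by (rule prod.reindex_bij_witness[where i = "\<lambda>x. a * x" and j = "\<lambda>x. x / a"])
      (use assms in auto)
  also have "\<dots> = a ^ (CARD('a) - 1) * (\<Prod>x\<in>UNIV - {0}. x)"
    by (simp add: prod.distrib card_Diff_singleton)
  finally show ?thesis
    by (simp add: mult_cancel_right1)
qed

section \<open>Code locators, parity checks and syndromes\<close>

lemma locators_index [simp]:
  "i < CARD('a) \<Longrightarrow>
    locators (\<alpha>::'a::{field,finite}) $ i = (if i = 0 then 0 else \<alpha> ^ (i - 1))"
  by (simp add: locators_def)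

text \<open>Surjectivity suffices, because there are as many indices as field elements.\<close>

lemma bij_betw_locators:
  assumes "primitive_element (\<alpha>::'a::{field,finite})"
  shows "bij_betw (\<lambda>i. locators \<alpha> $ i) {..<CARD('a)} UNIV"
proof -
  have "x \<in> (\<lambda>i. locators \<alpha> $ i) ` {..<CARD('a)}" for x
  proof (cases "x = 0")
    case True
    then show ?thesis
      by (intro image_eqI[of _ _ 0]) auto
  next
    case False
    have \<alpha>: "\<alpha> \<noteq> 0"
      using assms by (simp add: primitive_element_def)
    obtain e where "x = \<alpha> ^ e"
      using assms False by (auto simp: primitive_element_def)
    \<comment> \<open>\<open>primitive_element\<close> permits any natural exponent; reduction
      modulo the group order brings it into the range of the locator indices. Index 0 holds the
      locator 0, so \<alpha> to the power \<open>t\<close> sits at index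
      \<open>Suc t\<close>.\<close>
    define t where "t = e mod (CARD('a) - 1)"
    have "x = \<alpha> ^ ((CARD('a) - 1) * (e div (CARD('a) - 1)) + t)"
      by (simp add: t_def \<open>x = \<alpha> ^ e\<close>)
    then have "x = \<alpha> ^ t"
      by (simp only: power_add power_mult power_card_minus_1_eq_1[OF \<alpha>]) simp
    moreover have "t < CARD('a) - 1"
      using two_le_card_field[where 'a = 'a] by (simp add: t_def)
    ultimately show ?thesis
      by (intro image_eqI[of _ _ "Suc t"]) auto
  qed
  then have "(\<lambda>i. locators \<alpha> $ i) ` {..<CARD('a)} = UNIV"
    by blast
  then show ?thesis
    by (simp add: bij_betw_def eq_card_imp_inj_on)
qed

text \<open>The locators enumerate the field, so this is the sum of all values of
  \<open>x ^ r * p(x)\<close>, whose degree is at most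
  \<open>r + k - 1 < CARD('a) - 1\<close>.\<close>

lemma RS_code_parity_check:
  assumes "primitive_element (\<alpha>::'a::{field,finite})" and "1 \<le> k"
    and "c \<in> RS_code \<alpha> k" and "r < CARD('a) - k"
  shows "(\<Sum>i<CARD('a). (locators \<alpha> $ i) ^ r * c $ i) = 0"
proof -
  obtain p where c: "c = vec CARD('a) (\<lambda>i. poly p (locators \<alpha> $ i))"
    and "p = 0 \<or> Polynomial.degree p < k"
    using assms(3) by (auto simp: RS_code_def)
  \<comment> \<open>The zero polynomial has degree 0 here, which is below \<open>k\<close> by
    \<open>1 \<le> k\<close>.\<close>
  then have "Polynomial.degree p < k"
    using assms(2) by auto
  then have "Polynomial.degree (Polynomial.monom 1 r * p) < CARD('a) - 1"
    using assms(4) degree_mult_le[of "Polynomial.monom 1 r" p] degree_monom_le[of "1::'a" r]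
    by linarith
  note sum_poly_UNIV_eq_0[OF this]
  also have "(\<Sum>x\<in>UNIV. poly (Polynomial.monom 1 r * p) x) =
      (\<Sum>i<CARD('a). poly (Polynomial.monom 1 r * p) (locators \<alpha> $ i))"
    by (rule sum.reindex_bij_betw[symmetric, OF bij_betw_locators[OF assms(1)]])
  also have "\<dots> = (\<Sum>i<CARD('a). (locators \<alpha> $ i) ^ r * c $ i)"
    by (intro sum.cong) (auto simp: c poly_monom)
  finally show ?thesis .
qed

lemma nonzero_rows_entry_eq_0:
  assumes "i < dim_row E" and "i \<notin> nonzero_rows E" and "j < dim_col E"
  shows "E $$ (i, j) = 0"
proof -
  have "row E i = 0\<^sub>v (dim_col E)"
    using assms by (simp add: nonzero_rows_def)
  then have "row E i $ j = 0"
    using assms(3) by simp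
  then show ?thesis
    using assms by simp
qed

text \<open>The syndrome depends on the error alone: the parity checks remove the codeword, and zero
  rows of \<open>E\<close> contribute nothing.\<close>

lemma syndrome_index:
  assumes "primitive_element (\<alpha>::'a::{field,finite})" and "1 \<le> k"
    and A: "A \<in> IRS_code \<alpha> l k" and E: "E \<in> carrier_mat CARD('a) l"
    and r: "r < CARD('a) - k" and j: "j < l"
  shows "(check_matrix \<alpha> k * (A + E)) $$ (r, j) =
    (\<Sum>i\<in>nonzero_rows E. (locators \<alpha> $ i) ^ r * E $$ (i, j))"
proof -
  have Ac: "A \<in> carrier_mat CARD('a) l" and "col A j \<in> RS_code \<alpha> k"
    using A j by (auto simp: IRS_code_def)
  note parity = RS_code_parity_check[OF assms(1,2) this(2) r]
  have "(check_matrix \<alpha> k * (A + E)) $$ (r, j) =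
      (\<Sum>i<CARD('a). (locators \<alpha> $ i) ^ r * (A $$ (i, j) + E $$ (i, j)))"
    using Ac E r j
    by (auto simp: check_matrix_def scalar_prod_def lessThan_atLeast0 intro!: sum.cong)
  also have "\<dots> = (\<Sum>i<CARD('a). (locators \<alpha> $ i) ^ r * col A j $ i) +
      (\<Sum>i<CARD('a). (locators \<alpha> $ i) ^ r * E $$ (i, j))"
    using Ac j unfolding sum.distrib[symmetric]
    by (intro sum.cong) (auto simp: distrib_left)
  also have "\<dots> = (\<Sum>i<CARD('a). (locators \<alpha> $ i) ^ r * E $$ (i, j))"
    using parity by simp
  also have "\<dots> = (\<Sum>i\<in>nonzero_rows E. (locators \<alpha> $ i) ^ r * E $$ (i, j))"
    using E j nonzero_rows_entry_eq_0[of _ E j]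
    by (intro sum.mono_neutral_right) (auto simp: nonzero_rows_def)
  finally show ?thesis .
qed

section \<open>Linear independence of an indexed family of rows\<close>

lemma rows_lin_indptD:
  fixes E :: "'a::field mat"
  assumes ind: "rows_lin_indpt E I" and I: "I \<subseteq> {..<dim_row E}"
    and comb: "\<And>j. j < dim_col E \<Longrightarrow> (\<Sum>i\<in>I. d i * E $$ (i, j)) = 0"
    and "i \<in> I"
  shows "d i = 0"
proof (rule ccontr)
  assume "d i \<noteq> 0"
  interpret vec_space "TYPE('a)" "dim_col E" .
  have inj: "inj_on (row E) I" and "\<not> lin_dep (row E ` I)"
    using ind by (auto simp: rows_lin_indpt_def)
  \<comment> \<open>The library's combinations weight vectors, not indices; injectivity of
    \<open>row E\<close> lets the weight \<open>d i\<close> be transported to the vector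
    \<open>row E i\<close>.\<close>
  define a where "a = d \<circ> inv_into I (row E)"
  have a: "a (row E i) = d i" if "i \<in> I" for i
    using inj that by (simp add: a_def)
  have sub: "row E ` I \<subseteq> carrier_vec (dim_col E)" by auto
  have "lincomb a (row E ` I) = 0\<^sub>v (dim_col E)"
  proof (rule eq_vecI)
    fix j assume "j < dim_vec (0\<^sub>v (dim_col E) :: 'a vec)"
    then have j: "j < dim_col E" by simp
    have "lincomb a (row E ` I) $ j = (\<Sum>x\<in>row E ` I. a x * x $ j)"
      by (rule lincomb_index[OF j sub])
    also have "\<dots> = (\<Sum>i\<in>I. d i * E $$ (i, j))"
      unfolding sum.reindex[OF inj] using I j by (intro sum.cong) (auto simp: a)
    finally show "lincomb a (row E ` I) $ j = 0\<^sub>v (dim_col E) $ j"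
      using comb j by simp
  next
    show "dim_vec (lincomb a (row E ` I)) = dim_vec (0\<^sub>v (dim_col E) :: 'a vec)"
      using lincomb_dim[OF _ sub] finite_subset[OF I] by simp
  qed
  then have "lin_dep (row E ` I)"
    unfolding lin_dep_def using \<open>i \<in> I\<close> \<open>d i \<noteq> 0\<close> a finite_subset[OF I]
    by (intro exI[of _ "row E ` I"] exI[of _ a] exI[of _ "row E i"]) auto
  then show False
    using \<open>\<not> lin_dep (row E ` I)\<close> by blast
qed

section \<open>Locator polynomials and their roots\<close>

lemma poly_locator_poly: "poly (locator_poly m c) x = x ^ m - (\<Sum>j<m. c $ j * x ^ j)"
  by (simp add: locator_poly_def poly_monom poly_sum)

lemma coeff_locator_poly:
  "coeff (locator_poly m c) j = (if j = m then 1 else if j < m then - (c $ j) else 0)"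
  by (auto simp: locator_poly_def coeff_sum)

lemma degree_locator_poly: "Polynomial.degree (locator_poly m c) = m"
  by (intro antisym degree_le le_degree) (auto simp: coeff_locator_poly)

lemma locator_poly_nonzero: "locator_poly m c \<noteq> 0"
proof
  assume "locator_poly m c = 0"
  then show False
    using coeff_locator_poly[of m c m] by simp
qed

lemma locator_poly_inject:
  assumes "c \<in> carrier_vec m" and "d \<in> carrier_vec m" and "locator_poly m c = locator_poly m d"
  shows "c = d"
proof (rule eq_vecI)
  fix j assume "j < dim_vec d"
  then have "j < m" using assms(2) by simp
  then show "c $ j = d $ j"
    using coeff_locator_poly[of m c j] coeff_locator_poly[of m d j] assms(3) by simp
qed (use assms in auto)

lemma locator_poly_coeffs:
  assumes "Polynomial.degree p = m" and "coeff p m = 1"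
  shows "locator_poly m (vec m (\<lambda>j. - coeff p j)) = p"
  using assms by (intro poly_eqI) (auto simp: coeff_locator_poly coeff_eq_0)

lemma card_le_of_locator_poly_roots:
  fixes c :: "'a::field vec"
  assumes "\<And>x. x \<in> R \<Longrightarrow> poly (locator_poly m c) x = 0"
  shows "card R \<le> m"
proof -
  have "card R \<le> card {x. poly (locator_poly m c) x = 0}"
    using assms by (intro card_mono) (auto simp: poly_roots_finite locator_poly_nonzero)
  then show ?thesis
    using card_poly_roots_bound[OF locator_poly_nonzero, of m c]
    by (simp add: degree_locator_poly)
qed

lemma degree_prod_linear_factors:
  "Polynomial.degree (\<Prod>a\<in>R. [:- a, 1::'a::field:]) = card R"
  by (subst degree_prod_eq_sum_degree) auto

lemma lead_coeff_prod_linear_factors: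
  "coeff (\<Prod>a\<in>R. [:- a, 1::'a::field:]) (card R) = 1"
  using lead_coeff_prod[of "\<lambda>a. [:- a, 1::'a:]" R] by (simp add: degree_prod_linear_factors)

text \<open>Both sides are monic of degree \<open>card R\<close> and vanish on \<open>R\<close>, so
  their difference has too many roots for its degree unless it is 0.\<close>

lemma locator_poly_eq_prod:
  fixes c :: "'a::field vec"
  assumes "\<And>x. x \<in> R \<Longrightarrow> poly (locator_poly (card R) c) x = 0" and "finite R"
  shows "locator_poly (card R) c = (\<Prod>a\<in>R. [:- a, 1:])"
proof (rule ccontr)
  let ?P = "\<Prod>a\<in>R. [:- a, 1:]"
  define D where "D = locator_poly (card R) c - ?P"
  assume "locator_poly (card R) c \<noteq> ?P"
  then have "D \<noteq> 0" by (simp add: D_def)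
  have "R \<subseteq> {x. poly D x = 0}"
    using assms by (auto simp: D_def poly_prod)
  then have "card R \<le> Polynomial.degree D"
    using card_mono[OF poly_roots_finite[OF \<open>D \<noteq> 0\<close>]] card_poly_roots_bound[OF \<open>D \<noteq> 0\<close>]
    by (meson le_trans)
  moreover have "Polynomial.degree D \<le> card R"
    unfolding D_def
    by (intro degree_diff_le) (simp_all add: degree_locator_poly degree_prod_linear_factors)
  \<comment> \<open>The roots force degree exactly \<open>card R\<close>, but there the two leading
    ones cancel.\<close>
  ultimately have "lead_coeff D = coeff D (card R)"
    by simp
  then have "lead_coeff D = 0"
    by (simp add: D_def coeff_locator_poly lead_coeff_prod_linear_factors)
  then show False
    using \<open>D \<noteq> 0\<close> by simp
qed

section \<open>Relations among syndrome rows\<close>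

lemma row_coeffs_index_iff:
  assumes "m < dim_row S"
  shows "row_coeffs S m c \<longleftrightarrow> c \<in> carrier_vec m \<and>
    (\<forall>j<dim_col S. S $$ (m, j) = (\<Sum>r<m. c $ r * S $$ (r, j)))"
proof -
  let ?v = "finsum_vec TYPE('a) (dim_col S) (\<lambda>r. c $ r \<cdot>\<^sub>v row S r) {0..<m}"
  have rows: "(\<lambda>r. c $ r \<cdot>\<^sub>v row S r) \<in> {0..<m} \<rightarrow> carrier_vec (dim_col S)"
    by auto
  have "?v $ j = (\<Sum>r<m. c $ r * S $$ (r, j))" if "j < dim_col S" for j
    using index_finsum_vec[OF _ that rows] that assms
    by (auto simp: lessThan_atLeast0 intro!: sum.cong)
  moreover have "dim_vec ?v = dim_col S"
    using finsum_vec_closed[OF rows] by simp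
  ultimately show ?thesis
    using assms by (auto simp: row_coeffs_def vec_eq_iff)
qed

text \<open>The bridge from rows to polynomials: row \<open>m\<close> minus the proposed combination
  is the sum of the error rows weighted by the values of the locator polynomial, and independence
  makes all these weights 0.\<close>

lemma row_coeffs_syndrome_iff:
  fixes \<alpha> :: "'a::{field,finite}"
  assumes "primitive_element \<alpha>" and "1 \<le> k"
    and "A \<in> IRS_code \<alpha> l k" and E: "E \<in> carrier_mat CARD('a) l"
    and ind: "rows_lin_indpt E (nonzero_rows E)" and m: "m < CARD('a) - k"
  shows "row_coeffs (check_matrix \<alpha> k * (A + E)) m c \<longleftrightarrow> c \<in> carrier_vec m \<and>
    (\<forall>i\<in>nonzero_rows E. poly (locator_poly m c) (locators \<alpha> $ i) = 0)"
proof -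
  let ?S = "check_matrix \<alpha> k * (A + E)"
  let ?F = "nonzero_rows E"
  let ?\<Lambda> = "\<lambda>i. poly (locator_poly m c) (locators \<alpha> $ i)"
  have dim: "dim_row ?S = CARD('a) - k" "dim_col ?S = l"
    using E by (auto simp: check_matrix_def)
  note syn = syndrome_index[OF assms(1-4)]
  have key: "?S $$ (m, j) - (\<Sum>r<m. c $ r * ?S $$ (r, j)) = (\<Sum>i\<in>?F. ?\<Lambda> i * E $$ (i, j))"
    if j: "j < l" for j
  proof -
    have "(\<Sum>r<m. c $ r * ?S $$ (r, j)) =
        (\<Sum>r<m. c $ r * (\<Sum>i\<in>?F. (locators \<alpha> $ i) ^ r * E $$ (i, j)))"
      using m j by (intro sum.cong) (auto simp: syn simp del: locators_index)
    also have "\<dots> = (\<Sum>i\<in>?F. (\<Sum>r<m. c $ r * (locators \<alpha> $ i) ^ r) * E $$ (i, j))"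
      by (simp only: sum_distrib_left sum_distrib_right mult.assoc) (rule sum.swap)
    finally show ?thesis
      using syn[OF m j]
      by (simp add: poly_locator_poly left_diff_distrib sum_subtractf del: locators_index)
  qed
  have "(\<forall>j<l. ?S $$ (m, j) = (\<Sum>r<m. c $ r * ?S $$ (r, j))) \<longleftrightarrow>
      (\<forall>j<l. (\<Sum>i\<in>?F. ?\<Lambda> i * E $$ (i, j)) = 0)"
    by (intro all_cong1 imp_cong refl) (simp only: key[symmetric] right_minus_eq)
  also have "\<dots> \<longleftrightarrow> (\<forall>i\<in>?F. ?\<Lambda> i = 0)"
  proof
    assume "\<forall>j<l. (\<Sum>i\<in>?F. ?\<Lambda> i * E $$ (i, j)) = 0"
    moreover have "?F \<subseteq> {..<dim_row E}"
      by (auto simp: nonzero_rows_def)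
    ultimately show "\<forall>i\<in>?F. ?\<Lambda> i = 0"
      using rows_lin_indptD[OF ind, of ?\<Lambda>] E by auto
  qed simp
  finally show ?thesis
    using m dim by (simp add: row_coeffs_index_iff del: locators_index)
qed

theorem theorem1:
  fixes \<alpha> :: "'a::{field,finite}"
    and n k l f fhat :: nat
    and v :: "'a vec"
    and A E Y H S :: "'a mat"
    and F :: "nat set"
  assumes "primitive_element \<alpha>"
    and "n = CARD('a)"
    and "1 \<le> k" and "k \<le> n - 1"
    and "1 \<le> l"
    and "v = locators \<alpha>"
    and "A \<in> IRS_code \<alpha> l k"
    and "E \<in> carrier_mat n l"
    and "Y = A + E"
    and "F = nonzero_rows E"
    and "f = card F"
    and "H = check_matrix \<alpha> k"
    and "S = H * Y"
    and "rows_lin_indpt E F"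
    and "f \<le> min l (n - k - 1)"
    and "fhat = first_dependent_row S"
  shows "(\<exists>m. dependent_row S m)
    \<and> (\<exists>!c. row_coeffs S fhat c)
    \<and> fhat = f
    \<and> (\<forall>c. row_coeffs S fhat c \<longrightarrow>
          (\<forall>i<n. poly (locator_poly fhat c) (v $ i) = 0 \<longleftrightarrow> i \<in> F))"
proof -
  define R where "R = (\<lambda>i. v $ i) ` F"
  have sub: "F \<subseteq> {..<n}"
    using assms(8,10) by (auto simp: nonzero_rows_def)
  then have fin: "finite F"
    by (rule finite_subset) simp
  have inj: "inj_on (\<lambda>i. v $ i) {..<n}"
    using bij_betw_locators[OF assms(1)] assms(2,6) by (simp add: bij_betw_def)
  then have card: "card R = f"
    unfolding R_def assms(11) by (intro card_image inj_on_subset[OF _ sub])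
  have finR: "finite R" using fin by (simp add: R_def)
  have coeffs: "row_coeffs S m c \<longleftrightarrow>
      c \<in> carrier_vec m \<and> (\<forall>x\<in>R. poly (locator_poly m c) x = 0)" if "m < n - k" for m c
    using row_coeffs_syndrome_iff[OF assms(1,3,7), of E m c] assms that by (auto simp: R_def)
  have dim: "dim_row S = n - k"
    using assms(2,12,13) by (simp add: check_matrix_def)
  have f: "f < n - k"
    \<comment> \<open>Since \<open>k \<le> n - 1\<close> and \<open>n \<ge> 2\<close>, the truncated
      difference \<open>n - k\<close> is positive.\<close>
    using assms(2-4,15) two_le_card_field[where 'a = 'a] by linarith
  let ?P = "\<Prod>a\<in>R. [:- a, 1:]"
  \<comment> \<open>The lower coefficients of \<open>?P\<close>, negated to match the signs in
    \<open>locator_poly\<close>, give a relation for row \<open>f\<close>.\<close>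
  let ?c = "vec f (\<lambda>j. - coeff ?P j)"
  have "locator_poly f ?c = ?P"
    using locator_poly_coeffs[OF degree_prod_linear_factors lead_coeff_prod_linear_factors, of R]
    by (simp add: card)
  then have exists: "row_coeffs S f ?c"
    using finR by (auto simp: coeffs[OF f] poly_prod)
  have locator: "locator_poly f c = ?P" if "row_coeffs S f c" for c
    using that locator_poly_eq_prod[of R c] finR by (simp add: coeffs[OF f] card)
  \<comment> \<open>Any two relations have the same locator polynomial \<open>?P\<close>, which
    determines the coefficients.\<close>
  have unique: "c = ?c" if "row_coeffs S f c" for c
    using locator[OF that] locator[OF exists] that exists
    by (intro locator_poly_inject[of _ f]) (auto simp: coeffs[OF f])
  have dep: "dependent_row S f"
    using exists f dim by (auto simp: dependent_row_def)
  \<comment> \<open>A dependent row \<open>m\<close> yields a monic polynomial of degree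
    \<open>m\<close> with the \<open>f\<close> distinct error locators as roots.\<close>
  have "f \<le> m" if m: "dependent_row S m" for m
  proof -
    obtain c where "m < n - k" and "row_coeffs S m c"
      using m dim by (auto simp: dependent_row_def)
    then show ?thesis
      using card_le_of_locator_poly_roots[of R m c] by (simp add: coeffs card)
  qed
  then have fhat: "fhat = f"
    unfolding assms(16) first_dependent_row_def using dep by (intro Least_equality)
  have "poly ?P (v $ i) = 0 \<longleftrightarrow> i \<in> F" if "i < n" for i
  proof -
    have "poly ?P (v $ i) = 0 \<longleftrightarrow> v $ i \<in> R"
      using finR by (auto simp: poly_prod)
    also have "\<dots> \<longleftrightarrow> i \<in> F"
      \<comment> \<open>Distinct indices have distinct locators, so \<open>v $ i\<close> can lie in
        \<open>R\<close> only if \<open>i\<close> itself is in \<open>F\<close>.\<close>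
      unfolding R_def using that sub by (intro inj_on_image_mem_iff[OF inj]) auto
    finally show ?thesis .
  qed
  moreover have "\<exists>!c. row_coeffs S f c"
    using exists unique by (rule ex1I)
  ultimately show ?thesis
    unfolding fhat using dep locator by auto
qed

end
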